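(* Let $E:\mathbb{R}^n\to\mathbb{R}^n$ and $\Psi:\mathbb{R}^n\times\mathbb{R}^n\to\mathbb{R}^n$ be maps. If the functions $h:\mathbb{R}^n\to\mathbb{R}$ and $h_j:\mathbb{R}^n\to\mathbb{R}$, $1\le j\le k$, are SSEP w.r.t. $\Psi$ on $\mathbb{R}^n$, then the set of optimal solutions of the problem (P): minimize $h(s)$ subject to $h_j(s)\le 0$, $1\le j\le k$, $s\in\mathbb{R}^n$, is an SEI set w.r.t. $\Psi$.
   Context: Write $Es$ for $E(s)$. A set $S\subseteq\mathbb{R}^n$ is strongly $E$-invex (SEI) w.r.t. $\Psi$ if $\alpha t+Et+\lambda\Psi(\alpha s+Es,\alpha t+Et)\in S$ for all $s,t\in S$, $\alpha\in[0,1]$, $\lambda\in[0,1]$. A function $h:\mathbb{R}^n\to\mathbb{R}$ is semi strongly $E$-preinvex (SSEP) w.r.t. $\Psi$ on an SEI set $S$ if $h(\alpha t+Et+\lambda\Psi(\alpha s+Es,\alpha t+Et))\le\lambda h(s)+(1-\lambda)h(t)$ for all $s,t\in S$, $\alpha,\lambda\in[0,1]$ ($\mathbb{R}^n$ itself is an SEI set). With $X=\{s\in\mathbb{R}^n:h_j(s)\le0,\ 1\le j\le k\}$ the feasible set, the set of optimal solutions of (P) is $X_{opt}=\{s\in X:h(s)=\beta\}$ where $\beta=\min_{s\in X}h(s)$, i.e. the set of minimizers of $h$ over $X$. *)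

theory Defs
  imports "HOL-Analysis.Analysis"
begin

definition strongly_E_invex ::
  "(real ^ 'n \<Rightarrow> real ^ 'n) \<Rightarrow> ((real ^ 'n) \<times> (real ^ 'n) \<Rightarrow> real ^ 'n) \<Rightarrow> (real ^ 'n) set \<Rightarrow> bool"
  where
  "strongly_E_invex E \<Psi> S \<longleftrightarrow>
    (\<forall>s\<in>S. \<forall>t\<in>S. \<forall>\<alpha>\<in>{0..1}. \<forall>\<mu>\<in>{0..1}.
      \<alpha> *\<^sub>R t + E t + \<mu> *\<^sub>R \<Psi> (\<alpha> *\<^sub>R s + E s, \<alpha> *\<^sub>R t + E t) \<in> S)"

text \<open>The domain of a semi strongly \<open>E\<close>-preinvex function is required to be strongly \<open>E\<close>-invex;
  for \<open>S = UNIV\<close> this holds trivially.\<close>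

definition semi_strongly_E_preinvex_on ::
  "(real ^ 'n) set \<Rightarrow> (real ^ 'n \<Rightarrow> real ^ 'n) \<Rightarrow> ((real ^ 'n) \<times> (real ^ 'n) \<Rightarrow> real ^ 'n) \<Rightarrow>
    (real ^ 'n \<Rightarrow> real) \<Rightarrow> bool"
  where
  "semi_strongly_E_preinvex_on S E \<Psi> h \<longleftrightarrow>
    strongly_E_invex E \<Psi> S \<and>
    (\<forall>s\<in>S. \<forall>t\<in>S. \<forall>\<alpha>\<in>{0..1}. \<forall>\<mu>\<in>{0..1}.
      h (\<alpha> *\<^sub>R t + E t + \<mu> *\<^sub>R \<Psi> (\<alpha> *\<^sub>R s + E s, \<alpha> *\<^sub>R t + E t))
        \<le> \<mu> * h s + (1 - \<mu>) * h t)"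

definition feasible_set :: "(nat \<Rightarrow> real ^ 'n \<Rightarrow> real) \<Rightarrow> nat \<Rightarrow> (real ^ 'n) set"
  where "feasible_set hc k = {s. \<forall>j\<in>{1..k}. hc j s \<le> 0}"

text \<open>The set of minimizers of \<open>h\<close> over the feasible set; it is empty if the minimum is not
  attained.\<close>

definition optimal_solutions ::
  "(real ^ 'n \<Rightarrow> real) \<Rightarrow> (nat \<Rightarrow> real ^ 'n \<Rightarrow> real) \<Rightarrow> nat \<Rightarrow> (real ^ 'n) set"
  where "optimal_solutions h hc k = {s. is_arg_min h (\<lambda>t. t \<in> feasible_set hc k) s}"

end

(* A nonempty set of minimizers is the intersection of the sublevel set of h at its minimum
   value with the zero sublevel sets of the constraints. Sublevel sets of semi strongly
   E-preinvex functions are strongly E-invex, and so are intersections of such sets. *)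
theory Submission
  imports Defs
begin

lemma strongly_E_invex_Inter:
  assumes "\<And>S. S \<in> \<S> \<Longrightarrow> strongly_E_invex E \<Psi> S"
  shows "strongly_E_invex E \<Psi> (\<Inter>\<S>)"
  using assms unfolding strongly_E_invex_def by blast

text \<open>The defining inequality bounds \<open>h\<close> at the new point by a convex combination
  of \<open>h s\<close> and \<open>h t\<close>, hence by \<open>c\<close> when both values are at
  most \<open>c\<close>.\<close>

lemma strongly_E_invex_sublevel:
  assumes "semi_strongly_E_preinvex_on UNIV E \<Psi> h"
  shows "strongly_E_invex E \<Psi> {s. h s \<le> c}"
  unfolding strongly_E_invex_def
proof (intro ballI)
  fix s t and \<alpha> \<mu> :: real
  assume s: "s \<in> {s. h s \<le> c}" and t: "t \<in> {s. h s \<le> c}"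
    and \<alpha>: "\<alpha> \<in> {0..1}" and \<mu>: "\<mu> \<in> {0..1}"
  let ?x = "\<alpha> *\<^sub>R t + E t + \<mu> *\<^sub>R \<Psi> (\<alpha> *\<^sub>R s + E s, \<alpha> *\<^sub>R t + E t)"
  have "h ?x \<le> \<mu> * h s + (1 - \<mu>) * h t"
    using assms \<alpha> \<mu> unfolding semi_strongly_E_preinvex_on_def by blast
  also have "\<dots> \<le> c"
    using s t \<mu> by (intro convex_bound_le) auto
  finally show "?x \<in> {s. h s \<le> c}" by simp
qed

text \<open>By transitivity, a feasible point whose value is at most that of the minimizer
  \<open>s0\<close> is itself a minimizer; conversely, no minimizer exceeds \<open>h s0\<close>,
  since \<open>s0\<close> is feasible.\<close>

lemma optimal_solutions_eq_Inter_sublevel: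
  assumes "s0 \<in> optimal_solutions h hc k"
  shows "optimal_solutions h hc k =
    \<Inter>(insert {s. h s \<le> h s0} ((\<lambda>j. {s. hc j s \<le> 0}) ` {1..k}))"
  using assms unfolding optimal_solutions_def feasible_set_def is_arg_min_linorder
  by (auto intro: order_trans)

theorem corollary1:
  fixes E :: "real ^ 'n \<Rightarrow> real ^ 'n"
    and \<Psi> :: "(real ^ 'n) \<times> (real ^ 'n) \<Rightarrow> real ^ 'n"
    and h :: "real ^ 'n \<Rightarrow> real"
    and hc :: "nat \<Rightarrow> real ^ 'n \<Rightarrow> real"
    and k :: nat
  assumes "semi_strongly_E_preinvex_on UNIV E \<Psi> h"
    and "\<And>j. 1 \<le> j \<Longrightarrow> j \<le> k \<Longrightarrow> semi_strongly_E_preinvex_on UNIV E \<Psi> (hc j)"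
  shows "strongly_E_invex E \<Psi> (optimal_solutions h hc k)"
proof (cases "optimal_solutions h hc k = {}")
  \<comment> \<open>This covers an infeasible problem and an unattained infimum; the condition is
    then vacuous.\<close>
  case True
  then show ?thesis by (simp add: strongly_E_invex_def)
next
  case False
  \<comment> \<open>Any minimizer serves: it only supplies the level \<open>h s0\<close>.\<close>
  then obtain s0 where "s0 \<in> optimal_solutions h hc k" by blast
  then show ?thesis
    unfolding optimal_solutions_eq_Inter_sublevel[OF \<open>s0 \<in> _\<close>]
    using assms by (intro strongly_E_invex_Inter) (auto intro: strongly_E_invex_sublevel)
qed

end
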